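(* Let $a$ be a positive integer. (i) The bijection $\varphi$ from numerical sets to partitions restricts to a bijection between the set of numerical sets $T$ with $a\in A(T)$ and the set of $a$-core partitions. (ii) The map $T\mapsto \mathrm{Ap}(T)$ taking a numerical set $T$ with $a\in A(T)$ to its Apéry tuple with respect to $a$ is a bijection from the set of numerical sets $T$ with $a\in A(T)$ to $\mathbb{N}^{a-1}$.
   Context: $\mathbb{N}=\{0,1,2,\dots\}$. A partition is a finite (possibly empty) weakly decreasing sequence of positive integers (its parts), represented by its Young diagram (left-aligned rows). The hook length of a box is the number of boxes directly to its right plus the number directly below it plus one. A partition is an $a$-core if none of its hook lengths is divisible by $a$. A numerical set is a subset $T\subseteq\mathbb{N}$ with $0\in T$ and $\mathbb{N}\setminus T$ finite. Its atom monoid is $A(T)=\{n\in\mathbb{N}: n+T\subseteq T\}$. The map $\varphi$ sends a numerical set $T$ to the partition whose Young diagram has the following profile (lower-right boundary), read from the bottom-left corner to the top-right: for $n=0,1,2,\dots$ take a unit step right if $n\in T$ and a unit step up if $n\notin T$ (the final infinite run of right steps is discarded). Equivalently, $\varphi(T)$ has one part for each $n\in\mathbb{N}\setminus T$, equal to $\#\{t\in T: t<n\}$. The map $\varphi$ is a bijection from numerical sets to partitions. For a numerical set $T$ with $a\in A(T)$, the Apéry tuple of $T$ with respect to $a$ is $\mathrm{Ap}(T)=(x_1,\dots,x_{a-1})\in\mathbb{N}^{a-1}$, where $ax_i+i$ is the smallest element of $T$ congruent to $i$ modulo $a$. *)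

theory Defs
  imports "HOL-Library.FuncSet" "HOL-Number_Theory.Cong"
begin

section \<open>Partitions, hook lengths and cores\<close>

definition is_partition :: "nat list \<Rightarrow> bool" where
  "is_partition p \<longleftrightarrow> sorted_wrt (\<ge>) p \<and> (\<forall>x\<in>set p. 0 < x)"

text \<open>Boxes are pairs (row, column), both counted from 0, with row 0 at the top.\<close>

definition young_diagram :: "nat list \<Rightarrow> (nat \<times> nat) set" where
  "young_diagram p = {(i, j). i < length p \<and> j < p ! i}"

definition hook_length :: "nat list \<Rightarrow> nat \<times> nat \<Rightarrow> nat" where
  "hook_length p = (\<lambda>(i, j).
     card {j'. j < j' \<and> (i, j') \<in> young_diagram p} +
     card {i'. i < i' \<and> (i', j) \<in> young_diagram p} + 1)"

definition core_partition :: "nat \<Rightarrow> nat list \<Rightarrow> bool" where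
  "core_partition a p \<longleftrightarrow>
     is_partition p \<and> (\<forall>b\<in>young_diagram p. \<not> a dvd hook_length p b)"


section \<open>Numerical sets\<close>

definition numerical_set :: "nat set \<Rightarrow> bool" where
  "numerical_set T \<longleftrightarrow> 0 \<in> T \<and> finite (- T)"

definition atom_monoid :: "nat set \<Rightarrow> nat set" where
  "atom_monoid T = {n. (+) n ` T \<subseteq> T}"

text \<open>
  A tuple indexed by 1, ..., a - 1 is a function on the set \<open>{1..<a}\<close> that is
  \<open>undefined\<close> elsewhere, so the set of all such tuples of naturals is
  \<open>{1..<a} \<rightarrow>\<^sub>E UNIV\<close>, a singleton for a = 1.
\<close>

definition apery_tuple :: "nat \<Rightarrow> nat set \<Rightarrow> nat \<Rightarrow> nat" where
  "apery_tuple a T =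
     (\<lambda>i\<in>{1..<a}. THE x. a * x + i = (LEAST n. n \<in> T \<and> [n = i] (mod a)))"


section \<open>The map from numerical sets to partitions\<close>

text \<open>
  The gaps are listed in decreasing order, so that the parts are weakly decreasing.
  The description by the profile of the Young diagram is \<open>profile_phi\<close> below.
\<close>

definition phi :: "nat set \<Rightarrow> nat list" where
  "phi T = map (\<lambda>n. card {t \<in> T. t < n}) (rev (sorted_list_of_set (- T)))"

datatype step = Step_Right | Step_Up

text \<open>
  The boundary walk from column \<open>c\<close> along the given rows, which are listed from
  bottom to top: in each row go right to the end of the row, then go up.
\<close>

fun boundary :: "nat \<Rightarrow> nat list \<Rightarrow> step list" where
  "boundary c [] = []"
| "boundary c (r # rs) = replicate (r - c) Step_Right @ Step_Up # boundary r rs"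

definition followed_by_rights :: "step list \<Rightarrow> nat \<Rightarrow> step" where
  "followed_by_rights w n = (if n < length w then w ! n else Step_Right)"

definition profile :: "nat list \<Rightarrow> nat \<Rightarrow> step" where
  "profile p = followed_by_rights (boundary 0 (rev p))"

lemma followed_by_rights_block:
  "followed_by_rights (replicate k Step_Right @ Step_Up # w) n =
    (if n < k then Step_Right else if n = k then Step_Up
     else followed_by_rights w (n - Suc k))"
  by (auto simp: followed_by_rights_def nth_append nth_Cons')

lemma card_below_add:
  fixes T :: "nat set"
  assumes "m \<le> g" "{m..<g} \<subseteq> T"
  shows "card {t \<in> T. t < g} = card {t \<in> T. t < m} + (g - m)"
proof -
  have "{t \<in> T. t < g} = {t \<in> T. t < m} \<union> {m..<g}"
    using assms by auto
  then show ?thesis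
    by (simp add: card_Un_disjoint disjoint_iff)
qed

lemma card_below_gap:
  fixes T :: "nat set"
  assumes "g \<notin> T"
  shows "card {t \<in> T. t < Suc g} = card {t \<in> T. t < g}"
proof -
  have "{t \<in> T. t < Suc g} = {t \<in> T. t < g}"
    using assms less_Suc_eq by auto
  then show ?thesis by simp
qed

lemma boundary_gaps:
  fixes T :: "nat set"
  assumes "sorted_wrt (<) gs" "set gs = {g. m \<le> g \<and> g \<notin> T}"
  shows "followed_by_rights
           (boundary (card {t \<in> T. t < m}) (map (\<lambda>n. card {t \<in> T. t < n}) gs)) n =
         (if m + n \<in> T then Step_Right else Step_Up)"
  using assms
proof (induction gs arbitrary: m n)
  case Nil
  then show ?case by (auto simp: followed_by_rights_def)
next
  case (Cons g gs)
  have g: "m \<le> g" "g \<notin> T" using Cons.prems(2) by auto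
  have sub: "{m..<g} \<subseteq> T"
  proof
    fix x assume x: "x \<in> {m..<g}"
    show "x \<in> T"
    proof (rule ccontr)
      assume "x \<notin> T"
      then have "x \<in> set (g # gs)" using x Cons.prems(2) by auto
      then show False using x Cons.prems(1) by auto
    qed
  qed
  have gs: "set gs = {h. Suc g \<le> h \<and> h \<notin> T}"
  proof (intro set_eqI iffI)
    fix x assume x: "x \<in> {h. Suc g \<le> h \<and> h \<notin> T}"
    then have "x \<in> set (g # gs)" using Cons.prems(2) g(1) by simp
    then show "x \<in> set gs" using x by simp
  next
    fix x assume x: "x \<in> set gs"
    then have "x \<in> set (g # gs)" by simp
    then have "x \<notin> T" using Cons.prems(2) by blast
    then show "x \<in> {h. Suc g \<le> h \<and> h \<notin> T}" using x Cons.prems(1) by auto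
  qed
  have IH: "followed_by_rights
      (boundary (card {t \<in> T. t < g}) (map (\<lambda>n. card {t \<in> T. t < n}) gs)) k =
      (if Suc g + k \<in> T then Step_Right else Step_Up)" for k
    using Cons.IH[of "Suc g" k] gs Cons.prems(1) card_below_gap[OF g(2)] by simp
  have d: "card {t \<in> T. t < g} - card {t \<in> T. t < m} = g - m"
    using card_below_add[OF g(1) sub] by simp
  consider "n < g - m" | "n = g - m" | k where "n = g - m + Suc k"
    by (metis less_iff_Suc_add linorder_cases add_Suc_right)
  then show ?case
  proof cases
    case 1
    then have "m + n \<in> T" using sub by auto
    then show ?thesis using 1 by (simp only: list.map boundary.simps d followed_by_rights_block) simp
  next
    case 2
    then have "m + n \<notin> T" using g by simp
    then show ?thesis using 2 by (simp only: list.map boundary.simps d followed_by_rights_block) simp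
  next
    case 3
    then have mn: "m + n = Suc g + k" using g by simp
    have n: "\<not> n < g - m" "n \<noteq> g - m" "n - Suc (g - m) = k" using 3 by auto
    then show ?thesis
      by (simp only: list.map boundary.simps d followed_by_rights_block n if_False IH mn)
  qed
qed

lemma profile_phi:
  assumes "numerical_set T"
  shows "profile (phi T) n = (if n \<in> T then Step_Right else Step_Up)"
  using boundary_gaps[of "sorted_list_of_set (- T)" 0 T n] assms
  by (simp add: profile_def phi_def rev_map numerical_set_def Compl_eq)

lemma gaps_boundary:
  fixes T :: "nat set"
  assumes "sorted rs" "\<forall>r\<in>set rs. c \<le> r" "c = card {t \<in> T. t < m}"
    and "\<And>n. m + n \<in> T \<longleftrightarrow> followed_by_rights (boundary c rs) n = Step_Right"
  shows "\<exists>gs. sorted_wrt (<) gs \<and> set gs = {g. m \<le> g \<and> g \<notin> T} \<and>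
              map (\<lambda>n. card {t \<in> T. t < n}) gs = rs"
  using assms
proof (induction rs arbitrary: c m)
  case Nil
  then have "{g. m \<le> g \<and> g \<notin> T} = {}"
    by (auto simp: followed_by_rights_def) (metis le_add_diff_inverse)
  then show ?case by (intro exI[of _ "[]"]) auto
next
  case (Cons r rs)
  define g where "g = m + (r - c)"
  have T: "m + n \<in> T \<longleftrightarrow> n < r - c \<or> (n \<noteq> r - c \<and>
      followed_by_rights (boundary r rs) (n - Suc (r - c)) = Step_Right)" for n
    using Cons.prems(4)[of n] by (auto simp: followed_by_rights_block)
  have g: "g \<notin> T" using T[of "r - c"] by (simp add: g_def)
  have sub: "{m..<g} \<subseteq> T"
  proof
    fix x assume "x \<in> {m..<g}"
    then show "x \<in> T" using T[of "x - m"] by (auto simp: g_def)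
  qed
  have r: "r = card {t \<in> T. t < g}"
    using card_below_add[OF _ sub] Cons.prems(2,3) by (simp add: g_def)
  have "Suc g + n \<in> T \<longleftrightarrow> followed_by_rights (boundary r rs) n = Step_Right" for n
    using T[of "Suc (r - c) + n"] by (simp add: g_def add_ac)
  then obtain gs where gs: "sorted_wrt (<) gs" "set gs = {h. Suc g \<le> h \<and> h \<notin> T}"
      "map (\<lambda>n. card {t \<in> T. t < n}) gs = rs"
    using Cons.IH[of r "Suc g"] Cons.prems(1) r card_below_gap[OF g] by auto
  have "set (g # gs) = {h. m \<le> h \<and> h \<notin> T}"
  proof (intro set_eqI iffI)
    fix x assume "x \<in> set (g # gs)"
    then show "x \<in> {h. m \<le> h \<and> h \<notin> T}" using gs(2) g by (auto simp: g_def)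
  next
    fix x assume x: "x \<in> {h. m \<le> h \<and> h \<notin> T}"
    then have "\<not> x < g" using sub by auto
    then have "x = g \<or> Suc g \<le> x" by linarith
    then show "x \<in> set (g # gs)" using x gs(2) by simp
  qed
  show ?case
  proof (intro exI[of _ "g # gs"] conjI)
    have "\<forall>h\<in>set gs. g < h" using gs(2) by (simp add: Suc_le_eq)
    then show "sorted_wrt (<) (g # gs)" using gs(1) by simp
    show "map (\<lambda>n. card {t \<in> T. t < n}) (g # gs) = r # rs" using gs(3) r by simp
  qed fact
qed

lemma partition_phi:
  assumes "numerical_set T"
  shows "is_partition (phi T)"
proof -
  have "sorted (map (\<lambda>n. card {t \<in> T. t < n}) (sorted_list_of_set (- T)))"
    unfolding sorted_map
    by (rule sorted_wrt_mono_rel[OF _ sorted_sorted_list_of_set])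
      (auto intro!: card_mono)
  moreover have "0 < card {t \<in> T. t < n}" if "n \<notin> T" for n
    using assms that by (auto simp: numerical_set_def card_gt_0_iff intro!: exI[of _ 0] gr0I)
  ultimately show ?thesis
    using assms
    by (auto simp: is_partition_def phi_def sorted_wrt_rev rev_map[symmetric] numerical_set_def)
qed

lemma bij_betw_phi: "bij_betw phi {T. numerical_set T} {p. is_partition p}"
proof (rule bij_betw_imageI)
  show "inj_on phi {T. numerical_set T}"
  proof (rule inj_onI)
    fix S T assume "S \<in> {T. numerical_set T}" "T \<in> {T. numerical_set T}" "phi S = phi T"
    then have "(if n \<in> S then Step_Right else Step_Up) = (if n \<in> T then Step_Right else Step_Up)" for n
      by (metis mem_Collect_eq profile_phi)
    then show "S = T" by (metis step.distinct(1) set_eqI)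
  qed
  show "phi ` {T. numerical_set T} = {p. is_partition p}"
  proof (intro equalityI subsetI)
    fix p assume "p \<in> phi ` {T. numerical_set T}"
    then show "p \<in> {p. is_partition p}" using partition_phi by auto
  next
    fix p assume "p \<in> {p. is_partition p}"
    then have p: "sorted (rev p)" "\<forall>r\<in>set (rev p). 0 < r"
      by (auto simp: is_partition_def sorted_wrt_rev)
    define T where "T = {n. profile p n = Step_Right}"
    have "\<exists>gs. sorted_wrt (<) gs \<and> set gs = {g. 0 \<le> g \<and> g \<notin> T} \<and>
              map (\<lambda>n. card {t \<in> T. t < n}) gs = rev p"
      by (rule gaps_boundary[where c = 0]) (use p in \<open>auto simp: T_def profile_def\<close>)
    then obtain gs where gs: "sorted_wrt (<) gs" "set gs = - T"
        "map (\<lambda>n. card {t \<in> T. t < n}) gs = rev p"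
      by auto
    have "0 \<in> T"
      using p(2) by (cases "rev p") (auto simp: T_def profile_def followed_by_rights_def nth_append)
    moreover have "finite (- T)" using gs(2) by (metis List.finite_set)
    ultimately have "numerical_set T" by (simp add: numerical_set_def)
    moreover have "sorted_list_of_set (- T) = gs"
      using gs by (metis sorted_list_of_set.idem_if_sorted_distinct strict_sorted_iff)
    then have "phi T = p" using gs(3) by (simp add: phi_def rev_map[symmetric])
    ultimately show "p \<in> phi ` {T. numerical_set T}" by blast
  qed
qed

end

(*
  The box of phi T in the row of a gap g and the column of the j-th element t of T has
  t < g, and its hook length is g - t: the arm counts the elements of T strictly between
  t and g, the leg counts the gaps strictly between them. So phi T is an a-core iff a
  divides no difference g - t > 0 of a gap and an element, i.e. iff T is closed under
  adding a. Such a set T is determined by its least elements a * x i + i in the nonzero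
  residue classes i, since it contains the multiples of a and is upward closed in each
  class, and all choices of the x i occur.
*)

theory Submission
  imports Defs
begin

section \<open>Hook lengths of the partition of a numerical set\<close>

text \<open>An element \<open>t\<close> below \<open>n\<close> is counted for \<open>n\<close> but
  not for itself. The number of elements below \<open>t\<close> is the column index of
  \<open>t\<close>, so for a gap \<open>n\<close> this tells which rows reach that column.\<close>

lemma card_below_less_iff:
  fixes T :: "nat set"
  assumes "t \<in> T"
  shows "card {s \<in> T. s < t} < card {s \<in> T. s < n} \<longleftrightarrow> t < n"
proof
  assume "t < n"
  then have "{s \<in> T. s < t} \<subset> {s \<in> T. s < n}"
    using assms by auto
  then show "card {s \<in> T. s < t} < card {s \<in> T. s < n}"
    by (intro psubset_card_mono) auto
next
  assume less: "card {s \<in> T. s < t} < card {s \<in> T. s < n}"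
  show "t < n"
  proof (rule ccontr)
    assume "\<not> t < n"
    then have "card {s \<in> T. s < n} \<le> card {s \<in> T. s < t}"
      by (intro card_mono) auto
    then show False using less by simp
  qed
qed

text \<open>Counting the elements below is injective on the elements under \<open>n\<close>, with
  values under the count for \<open>n\<close>. By cardinality every such value occurs, so each
  column met by a row comes from an element.\<close>

lemma ex_card_below_eq:
  fixes T :: "nat set"
  assumes "j < card {t \<in> T. t < n}"
  obtains t where "t \<in> T" "t < n" "card {s \<in> T. s < t} = j"
proof -
  let ?f = "\<lambda>t. card {s \<in> T. s < t}"
  have inj: "inj_on ?f {t \<in> T. t < n}"
    by (rule inj_onI)
      (metis (mono_tags, lifting) card_below_less_iff linorder_neqE_nat mem_Collect_eq order_less_irrefl)
  have "?f ` {t \<in> T. t < n} = {..<?f n}"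
    by (intro card_subset_eq) (auto simp: card_below_less_iff card_image[OF inj])
  then have "j \<in> ?f ` {t \<in> T. t < n}"
    using assms by simp
  then show thesis using that by blast
qed

lemma hook_length_phi:
  assumes T: "numerical_set T" and t: "t \<in> T"
    and i: "i < length (phi T)" and g: "g = rev (sorted_list_of_set (- T)) ! i"
    and tg: "t < g"
  shows "hook_length (phi T) (i, card {s \<in> T. s < t}) = g - t"
proof -
  define gs where "gs = rev (sorted_list_of_set (- T))"
  let ?f = "\<lambda>n. card {s \<in> T. s < n}"
  have nth: "phi T ! k = ?f (gs ! k)" if "k < length gs" for k
    using that by (simp add: phi_def gs_def)
  have len: "length (phi T) = length gs"
    by (simp add: phi_def gs_def)
  have set_gs: "set gs = - T" and "sorted_wrt (>) gs"
    using T by (simp_all add: gs_def numerical_set_def sorted_wrt_rev)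
  then have less_iff: "gs ! k < gs ! l \<longleftrightarrow> l < k" if "k < length gs" "l < length gs" for k l
    using that by (metis linorder_neqE_nat order_less_asym order_less_irrefl sorted_wrt_nth_less)
  have dist: "distinct gs" by (simp add: gs_def)
  have i': "i < length gs" and g': "gs ! i = g"
    using i g len by (simp_all add: gs_def)
  \<comment> \<open>The row of \<open>g\<close> has length \<open>?f g\<close>, so the boxes to the
    right fill an open interval of column indices.\<close>
  have arm: "{j'. ?f t < j' \<and> (i, j') \<in> young_diagram (phi T)} = {?f t<..<?f g}"
    using i' g' by (auto simp: young_diagram_def len nth)
  let ?leg = "{i'. i < i' \<and> (i', ?f t) \<in> young_diagram (phi T)}"
  have leg: "?leg = {k. i < k \<and> k < length gs \<and> t < gs ! k}"
    by (auto simp: young_diagram_def len nth card_below_less_iff[OF t])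
  \<comment> \<open>Since \<open>gs\<close> is decreasing, the rows below row \<open>i\<close> are
    those of the gaps smaller than \<open>g\<close>.\<close>
  have image_leg: "(!) gs ` ?leg = {h. t < h \<and> h < g \<and> h \<notin> T}"
  proof (intro equalityI subsetI)
    fix h assume "h \<in> (!) gs ` ?leg"
    then obtain k where k: "i < k" "k < length gs" "t < gs ! k" "h = gs ! k"
      unfolding leg by auto
    then have "h \<in> - T" using set_gs nth_mem by blast
    moreover have "h < g" using k less_iff[of k i] i' g' by simp
    ultimately show "h \<in> {h. t < h \<and> h < g \<and> h \<notin> T}"
      using k by simp
  next
    fix h assume h: "h \<in> {h. t < h \<and> h < g \<and> h \<notin> T}"
    then obtain k where "k < length gs" "gs ! k = h"
      using set_gs by (auto simp: in_set_conv_nth set_eq_iff)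
    then show "h \<in> (!) gs ` ?leg"
      unfolding leg using h less_iff i' g' by auto
  qed
  have "inj_on ((!) gs) ?leg"
    unfolding leg by (rule inj_on_nth[OF dist]) simp
  from card_image[OF this, unfolded image_leg]
  have card_leg: "card ?leg = card {h. t < h \<and> h < g \<and> h \<notin> T}"
    by (rule sym)
  have "{s \<in> T. s < g} = {s \<in> T. s < t} \<union> {s \<in> T. t \<le> s \<and> s < g}"
    using tg by auto
  then have card_T: "?f g = ?f t + card {s \<in> T. t \<le> s \<and> s < g}"
    by (simp add: card_Un_disjoint disjoint_iff)
  \<comment> \<open>The interval includes \<open>t\<close> itself, which accounts for the box at the
    corner of the hook.\<close>
  have "{t..<g} = {s \<in> T. t \<le> s \<and> s < g} \<union> {h. t < h \<and> h < g \<and> h \<notin> T}"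
    using t by (auto simp: order_less_le)
  then have "g - t = card ({s \<in> T. t \<le> s \<and> s < g} \<union> {h. t < h \<and> h < g \<and> h \<notin> T})"
    by (simp flip: card_atLeastLessThan)
  also have "\<dots> = card {s \<in> T. t \<le> s \<and> s < g} + card {h. t < h \<and> h < g \<and> h \<notin> T}"
    by (rule card_Un_disjoint) auto
  finally have "g - t = card {s \<in> T. t \<le> s \<and> s < g} + card {h. t < h \<and> h < g \<and> h \<notin> T}" .
  \<comment> \<open>The arm has \<open>?f g - Suc (?f t)\<close> boxes; the strict inequality keeps
    this subtraction from being truncated.\<close>
  moreover have "?f t < ?f g"
    using card_below_less_iff[OF t] tg by simp
  ultimately show ?thesis
    by (simp add: hook_length_def arm card_leg card_T)
qed

text \<open>Rows correspond to gaps and columns to elements, so every box is covered by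
  \<open>hook_length_phi\<close>. Being a core thereby becomes a condition on differences
  alone.\<close>

lemma hook_lengths_phi:
  assumes T: "numerical_set T"
  shows "hook_length (phi T) ` young_diagram (phi T) = {g - t | g t. t \<in> T \<and> g \<notin> T \<and> t < g}"
proof (intro equalityI subsetI)
  let ?gs = "rev (sorted_list_of_set (- T))"
  have fin: "finite (- T)" using T by (simp add: numerical_set_def)
  have set_gs: "set ?gs = - T" using fin by simp
  fix x
  {
    assume "x \<in> hook_length (phi T) ` young_diagram (phi T)"
    then obtain i j where ij: "i < length (phi T)" "j < phi T ! i" "x = hook_length (phi T) (i, j)"
      by (auto simp: young_diagram_def)
    have len: "i < length ?gs" using ij(1) by (simp add: phi_def)
    then have "?gs ! i \<notin> T" using set_gs nth_mem by blast
    moreover have "j < card {s \<in> T. s < ?gs ! i}"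
      using ij(2) len by (simp add: phi_def)
    then obtain t where "t \<in> T" "t < ?gs ! i" "card {s \<in> T. s < t} = j"
      by (rule ex_card_below_eq)
    ultimately show "x \<in> {g - t | g t. t \<in> T \<and> g \<notin> T \<and> t < g}"
      using hook_length_phi[OF T _ ij(1) refl] ij(3) by auto
  next
    assume "x \<in> {g - t | g t. t \<in> T \<and> g \<notin> T \<and> t < g}"
    then obtain g t where gt: "t \<in> T" "g \<notin> T" "t < g" "x = g - t" by auto
    then obtain i where i: "i < length ?gs" "?gs ! i = g"
      using set_gs by (metis ComplI in_set_conv_nth)
    have len: "i < length (phi T)" using i(1) by (simp add: phi_def)
    have "phi T ! i = card {s \<in> T. s < g}" using i by (simp add: phi_def)
    then have "(i, card {s \<in> T. s < t}) \<in> young_diagram (phi T)"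
      using len gt(3) by (simp add: young_diagram_def card_below_less_iff[OF gt(1)])
    moreover have "hook_length (phi T) (i, card {s \<in> T. s < t}) = x"
      using hook_length_phi[OF T gt(1) len i(2)[symmetric] gt(3)] gt(4) by simp
    ultimately show "x \<in> hook_length (phi T) ` young_diagram (phi T)"
      by (rule rev_image_eqI[OF _ sym])
  }
qed

section \<open>Cores and closure under adding \<open>a\<close>\<close>

lemma atom_monoid_iff: "a \<in> atom_monoid T \<longleftrightarrow> (\<forall>t\<in>T. a + t \<in> T)"
  by (simp add: atom_monoid_def image_subset_iff)

lemma atom_monoid_mult_add:
  assumes "a \<in> atom_monoid T" "t \<in> T"
  shows "a * k + t \<in> T"
proof (induction k)
  case (Suc k)
  then show ?case using assms(1) by (simp add: atom_monoid_iff add.assoc)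
qed (simp add: assms(2))

lemma core_partition_phi_iff:
  assumes T: "numerical_set T" and "0 < a"
  shows "core_partition a (phi T) \<longleftrightarrow> a \<in> atom_monoid T"
proof -
  have "core_partition a (phi T) \<longleftrightarrow>
      (\<forall>h \<in> hook_length (phi T) ` young_diagram (phi T). \<not> a dvd h)"
    using partition_phi[OF T] by (simp add: core_partition_def)
  also have "\<dots> \<longleftrightarrow> (\<forall>g t. t \<in> T \<and> g \<notin> T \<and> t < g \<longrightarrow> \<not> a dvd g - t)"
    unfolding hook_lengths_phi[OF T] by blast
  also have "\<dots> \<longleftrightarrow> a \<in> atom_monoid T"
  proof
    assume core: "\<forall>g t. t \<in> T \<and> g \<notin> T \<and> t < g \<longrightarrow> \<not> a dvd g - t"
    show "a \<in> atom_monoid T"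
      unfolding atom_monoid_iff
    proof
      fix t assume "t \<in> T"
      then show "a + t \<in> T"
        \<comment> \<open>If \<open>a + t\<close> were a gap, its difference from \<open>t\<close>
          would be \<open>a\<close>, which \<open>a\<close> divides.\<close>
        using core[rule_format, of t "a + t"] \<open>0 < a\<close> by auto
    qed
  next
    assume a: "a \<in> atom_monoid T"
    show "\<forall>g t. t \<in> T \<and> g \<notin> T \<and> t < g \<longrightarrow> \<not> a dvd g - t"
    proof (intro allI impI notI)
      fix g t assume gt: "t \<in> T \<and> g \<notin> T \<and> t < g" and "a dvd g - t"
      then obtain k where "g - t = a * k" by blast
      then have "g = a * k + t" using gt by linarith
      then show False using atom_monoid_mult_add[OF a] gt by blast
    qed
  qed
  finally show ?thesis .
qed

section \<open>Apery tuples\<close>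

text \<open>An infinite progression cannot lie in the finite complement of \<open>T\<close>, so the
  minimum exists. Numbers congruent to \<open>i\<close> have the form \<open>a * x + i\<close>, and
  minimizing them means minimizing \<open>x\<close>.\<close>

lemma apery_tuple_eq_Least:
  assumes T: "numerical_set T" and i: "i \<in> {1..<a}"
  shows "apery_tuple a T i = (LEAST x. a * x + i \<in> T)"
    and "a * apery_tuple a T i + i \<in> T"
proof -
  let ?x = "LEAST x. a * x + i \<in> T"
  have a: "0 < a" using i by simp
  have "\<exists>x. a * x + i \<in> T"
  proof (rule ccontr)
    assume "\<nexists>x. a * x + i \<in> T"
    then have "range (\<lambda>x. a * x + i) \<subseteq> - T" by auto
    then have "finite (range (\<lambda>x. a * x + i))"
      using T finite_subset by (auto simp: numerical_set_def)
    moreover have "inj (\<lambda>x. a * x + i)"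
      using a by (auto intro: injI)
    ultimately show False using finite_imageD infinite_UNIV_nat by blast
  qed
  then have x: "a * ?x + i \<in> T" by (rule LeastI_ex)
  have "(LEAST n. n \<in> T \<and> [n = i] (mod a)) = a * ?x + i"
  proof (rule Least_equality)
    show "a * ?x + i \<in> T \<and> [a * ?x + i = i] (mod a)"
      using x by (simp add: cong_def)
  next
    fix n assume n: "n \<in> T \<and> [n = i] (mod a)"
    then have "n mod a = i" using i by (simp add: cong_def)
    then have eq: "n = a * (n div a) + i" by (metis mult_div_mod_eq)
    then have "?x \<le> n div a" using n by (intro Least_le) simp
    then have "a * ?x \<le> a * (n div a)" by simp
    then show "a * ?x + i \<le> n" using eq by linarith
  qed
  then show "apery_tuple a T i = ?x"
    using i a by (simp add: apery_tuple_def)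
  then show "a * apery_tuple a T i + i \<in> T" using x by simp
qed

text \<open>Adding \<open>a\<close> repeatedly leads from 0 to all multiples of \<open>a\<close>,
  and from the least element of any other class to everything above it in that class. The class of 0
  is separate because the tuple starts at index 1.\<close>

lemma mem_iff_apery_tuple:
  assumes T: "numerical_set T" and aT: "a \<in> atom_monoid T" and "0 < a"
  shows "n \<in> T \<longleftrightarrow> n mod a = 0 \<or> apery_tuple a T (n mod a) \<le> n div a"
proof (cases "n mod a = 0")
  case True
  then have "n = a * (n div a) + 0" by (metis mult_div_mod_eq)
  then show ?thesis
    using True atom_monoid_mult_add[OF aT, of 0 "n div a"] T by (simp add: numerical_set_def)
next
  case False
  define i where "i = n mod a"
  let ?x = "apery_tuple a T i"
  have i: "i \<in> {1..<a}" using False \<open>0 < a\<close> by (simp add: i_def)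
  have n: "n = a * (n div a) + i" by (simp add: i_def)
  have "?x \<le> n div a" if "n \<in> T"
    unfolding apery_tuple_eq_Least(1)[OF T i] using that n by (intro Least_le) simp
  moreover have "n \<in> T" if "?x \<le> n div a"
  proof -
    have "n = a * (n div a - ?x) + (a * ?x + i)"
      using n that by (simp add: diff_mult_distrib2)
    then show ?thesis
      using atom_monoid_mult_add[OF aT apery_tuple_eq_Least(2)[OF T i]] by metis
  qed
  ultimately show ?thesis using False by (auto simp: i_def)
qed

text \<open>The criterion \<open>mem_iff_apery_tuple\<close> recovers \<open>T\<close> from its
  tuple, which gives injectivity; taken as a definition of \<open>T\<close>, it gives
  surjectivity.\<close>

lemma bij_betw_apery_tuple:
  assumes "0 < a"
  shows "bij_betw (apery_tuple a) {T. numerical_set T \<and> a \<in> atom_monoid T}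
           ({1..<a} \<rightarrow>\<^sub>E UNIV)"
proof (rule bij_betw_imageI)
  show "inj_on (apery_tuple a) {T. numerical_set T \<and> a \<in> atom_monoid T}"
    using mem_iff_apery_tuple[OF _ _ assms] by (intro inj_onI set_eqI) simp
  show "apery_tuple a ` {T. numerical_set T \<and> a \<in> atom_monoid T} = {1..<a} \<rightarrow>\<^sub>E UNIV"
  proof (intro equalityI subsetI)
    fix x assume "x \<in> apery_tuple a ` {T. numerical_set T \<and> a \<in> atom_monoid T}"
    then show "x \<in> {1..<a} \<rightarrow>\<^sub>E UNIV"
      by (auto simp: apery_tuple_def)
  next
    fix x :: "nat \<Rightarrow> nat" assume x: "x \<in> {1..<a} \<rightarrow>\<^sub>E UNIV"
    define T where "T = {n. n mod a = 0 \<or> x (n mod a) \<le> n div a}"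
    \<comment> \<open>An inclusion suffices for finiteness: for \<open>i = 0\<close> the value
      \<open>x 0\<close> is the unspecified \<open>undefined\<close>, but it still contributes only
      finitely many numbers.\<close>
    have "- T \<subseteq> (\<Union>i<a. (\<lambda>m. a * m + i) ` {..<x i})"
    proof
      fix n assume "n \<in> - T"
      then have "n div a < x (n mod a)" by (simp add: T_def)
      then show "n \<in> (\<Union>i<a. (\<lambda>m. a * m + i) ` {..<x i})"
        using assms by (intro UN_I[of "n mod a"] image_eqI[of _ _ "n div a"]) auto
    qed
    then have "finite (- T)"
      by (rule finite_subset) auto
    then have T: "numerical_set T"
      by (simp add: numerical_set_def T_def)
    have aT: "a \<in> atom_monoid T"
      \<comment> \<open>Adding \<open>a\<close> keeps the remainder and raises the quotient by
        one.\<close>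
      using assms by (auto simp: atom_monoid_iff T_def div_add_self1)
    have "apery_tuple a T = x"
    proof (rule extensionalityI[of _ "{1..<a}"])
      show "apery_tuple a T \<in> extensional {1..<a}"
        by (simp add: apery_tuple_def)
      show "x \<in> extensional {1..<a}"
        using x by (simp add: PiE_def)
      fix i assume i: "i \<in> {1..<a}"
      then have "a * m + i \<in> T \<longleftrightarrow> x i \<le> m" for m
        by (simp add: T_def)
      then show "apery_tuple a T i = x i"
        unfolding apery_tuple_eq_Least(1)[OF T i] by (simp add: Least_equality)
    qed
    then show "x \<in> apery_tuple a ` {T. numerical_set T \<and> a \<in> atom_monoid T}"
      using T aT by blast
  qed
qed

theorem proposition1p5:
  fixes a :: nat
  assumes "0 < a"
  shows "bij_betw phi {T. numerical_set T \<and> a \<in> atom_monoid T} {p. core_partition a p} \<and>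
         bij_betw (apery_tuple a) {T. numerical_set T \<and> a \<in> atom_monoid T}
           ({1..<a} \<rightarrow>\<^sub>E UNIV)"
proof
  \<comment> \<open>Injectivity is inherited from \<open>bij_betw_phi\<close>, so only the image of
    the restriction has to be found.\<close>
  have "phi ` {T. numerical_set T \<and> a \<in> atom_monoid T} = {p. core_partition a p}"
  proof (intro equalityI subsetI)
    fix p assume "p \<in> {p. core_partition a p}"
    moreover from this obtain T where "numerical_set T" "p = phi T"
      using bij_betw_imp_surj_on[OF bij_betw_phi] by (auto simp: core_partition_def)
    ultimately show "p \<in> phi ` {T. numerical_set T \<and> a \<in> atom_monoid T}"
      using core_partition_phi_iff[OF _ assms] by auto
  qed (auto simp: core_partition_phi_iff[OF _ assms])
  then show "bij_betw phi {T. numerical_set T \<and> a \<in> atom_monoid T} {p. core_partition a p}"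
    by (intro bij_betw_subset[OF bij_betw_phi]) auto
qed (rule bij_betw_apery_tuple[OF assms])

end
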